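(* Let $k$ be a field and let $J\subseteq R=k[x_1,\ldots,x_n]$ be a $C$-matroidal ideal with $\operatorname{ht} J=c$. Then $$\mathcal R_s(J)=R[Jt,\;SF_2(J)t^2,\;\ldots,\;SF_c(J)t^c].$$ In particular, the symbolic Noether number of $J$ is at most $c$.
   Context: A matroid on $[n]$ is identified with the simplicial complex whose facets are its bases (loops allowed). For $F\subseteq[n]$, $\mathfrak p_F=(x_i:i\in F)$. A squarefree monomial ideal is $C$-matroidal if it is the Stanley--Reisner ideal $I_\Delta=\bigcap_{F}\mathfrak p_{[n]-F}$ (intersection over the bases $F$) of a matroid $\Delta$ on $[n]$; equivalently, it is the cover ideal $J(\Delta)=\bigcap_F\mathfrak p_F$ of a matroid on $[n]$ (since $I_\Delta=J(\Delta^* )$, $\Delta^*$ the dual matroid). For a squarefree monomial ideal $J$, $J^{(\ell)}=\bigcap_{\mathfrak p\in\operatorname{Ass}(R/J)}\mathfrak p^\ell$, and $SF_\ell(J)$ is the ideal generated by all squarefree monomials in $J^{(\ell)}$ (so $SF_1(J)=J$). The symbolic Rees algebra is $\mathcal R_s(J)=\bigoplus_{\ell\ge0}J^{(\ell)}t^\ell\subseteq R[t]$ (with $J^{(0)}=R$); it is a finitely generated $R$-algebra. The symbolic Noether number of $J$ is the largest $t$-degree of a minimal $R$-algebra generator of $\mathcal R_s(J)$, i.e. the smallest $d\geq 0$ such that $\mathcal R_s(J)$ is generated as an $R$-algebra by elements of $t$-degree at most $d$. *)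

theory Defs
  imports
    "HOL-Library.Poly_Mapping"
    "HOL-Library.Extended_Nat"
    "HOL-Algebra.Ideal_Product"
    "HOL-Algebra.Generated_Rings"
    "HOL-Algebra.UnivPoly"
    "HOL-Algebra.Algebraic_Closure_Type"
begin

section \<open>Matroids\<close>

definition matroid :: "'a set \<Rightarrow> 'a set set \<Rightarrow> bool" where
  "matroid E \<Delta> \<longleftrightarrow>
     finite E \<and> \<Delta> \<subseteq> Pow E \<and> {} \<in> \<Delta> \<and>
     (\<forall>A\<in>\<Delta>. \<forall>B. B \<subseteq> A \<longrightarrow> B \<in> \<Delta>) \<and>
     (\<forall>A\<in>\<Delta>. \<forall>B\<in>\<Delta>. card A < card B \<longrightarrow> (\<exists>b\<in>B - A. insert b A \<in> \<Delta>))"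

text \<open>For a matroid, the facets are the bases.\<close>

definition facets :: "'a set set \<Rightarrow> 'a set set" where
  "facets \<Delta> = {F \<in> \<Delta>. \<forall>G\<in>\<Delta>. F \<subseteq> G \<longrightarrow> F = G}"


section \<open>Ideal-theoretic notions in a commutative ring\<close>

text \<open>The set of all r with r f in I is the annihilator of the class of f in R/I.\<close>

definition associated_primes :: "('a, 'b) ring_scheme \<Rightarrow> 'a set \<Rightarrow> 'a set set" where
  "associated_primes R I =
     {P. primeideal P R \<and> (\<exists>f\<in>carrier R. P = {r \<in> carrier R. r \<otimes>\<^bsub>R\<^esub> f \<in> I})}"

definition prime_height :: "('a, 'b) ring_scheme \<Rightarrow> 'a set \<Rightarrow> enat" where
  "prime_height R P =
     Sup {enat r | r. \<exists>C :: nat \<Rightarrow> 'a set.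
       (\<forall>i\<le>r. primeideal (C i) R) \<and> (\<forall>i<r. C i \<subset> C (Suc i)) \<and> C r = P}"

definition height :: "('a, 'b) ring_scheme \<Rightarrow> 'a set \<Rightarrow> enat" where
  "height R I = (INF P \<in> {P. primeideal P R \<and> I \<subseteq> P}. prime_height R P)"

text \<open>The powers are taken in the multiplicative monoid of ideals, so that the zeroth power
  of an ideal is the whole ring.\<close>

definition symbolic_power :: "('a, 'b) ring_scheme \<Rightarrow> 'a set \<Rightarrow> nat \<Rightarrow> 'a set" where
  "symbolic_power R I l =
     {f \<in> carrier R. \<forall>P\<in>associated_primes R I. f \<in> P [^]\<^bsub>ideals_set R\<^esub> l}"

definition symbolic_rees :: "('a, 'b) ring_scheme \<Rightarrow> 'a set \<Rightarrow> (nat \<Rightarrow> 'a) set" where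
  "symbolic_rees R I =
     {f \<in> carrier (UP R). \<forall>l. up_ring.coeff (UP R) f l \<in> symbolic_power R I l}"

text \<open>The set of all f t^l with f in A, inside R[t].\<close>

definition times_t_power :: "('a, 'b) ring_scheme \<Rightarrow> 'a set \<Rightarrow> nat \<Rightarrow> (nat \<Rightarrow> 'a) set" where
  "times_t_power R A l = (\<lambda>f. up_ring.monom (UP R) f l) ` A"

text \<open>The R-subalgebra R[S] of R[t] generated by a subset S.\<close>

definition adjoin :: "('a, 'b) ring_scheme \<Rightarrow> (nat \<Rightarrow> 'a) set \<Rightarrow> (nat \<Rightarrow> 'a) set" where
  "adjoin R S = generate_ring (UP R) (times_t_power R (carrier R) 0 \<union> S)"

text \<open>The infimum is taken in the extended naturals, so that the value is infinite (and not a
  junk natural number) if no degree bound on the generators exists.\<close>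

definition symbolic_Noether_number :: "('a, 'b) ring_scheme \<Rightarrow> 'a set \<Rightarrow> enat" where
  "symbolic_Noether_number R I =
     Inf {enat d | d. \<exists>S \<subseteq> symbolic_rees R I.
       (\<forall>f\<in>S. deg R f \<le> d) \<and> adjoin R S = symbolic_rees R I}"


section \<open>Squarefree monomial ideals in \<open>k[x\<^sub>1, \<dots>, x\<^sub>n]\<close>\<close>

text \<open>Polynomials over k in the variables x_0, x_1, ... are finitely supported functions from
  exponent vectors to k; k[x_1, ..., x_n] is the subring of those involving only
  x_1, ..., x_n.\<close>

type_synonym 'k mpol = "(nat \<Rightarrow>\<^sub>0 nat) \<Rightarrow>\<^sub>0 'k"

definition polynomial_ring :: "nat \<Rightarrow> 'k::field mpol ring" where
  "polynomial_ring n =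
     ring_of_type_algebra
       \<lparr>carrier := {f. \<forall>m\<in>Poly_Mapping.keys f. Poly_Mapping.keys m \<subseteq> {1..n}}\<rparr>"

definition indet :: "nat \<Rightarrow> 'k::field mpol" where
  "indet i = Poly_Mapping.single (Poly_Mapping.single i 1) 1"

definition var_ideal :: "nat \<Rightarrow> nat set \<Rightarrow> 'k::field mpol set" where
  "var_ideal n F = Idl\<^bsub>polynomial_ring n\<^esub> (indet ` F)"

definition Stanley_Reisner_ideal :: "nat \<Rightarrow> nat set set \<Rightarrow> 'k::field mpol set" where
  "Stanley_Reisner_ideal n \<Delta> = (\<Inter>F\<in>facets \<Delta>. var_ideal n ({1..n} - F))"

definition C_matroidal :: "nat \<Rightarrow> 'k::field mpol set \<Rightarrow> bool" where
  "C_matroidal n J \<longleftrightarrow> (\<exists>\<Delta>. matroid {1..n} \<Delta> \<and> J = Stanley_Reisner_ideal n \<Delta>)"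

definition squarefree_monomials :: "nat \<Rightarrow> 'k::field mpol set" where
  "squarefree_monomials n = {\<Prod>i\<in>A. indet i | A. A \<subseteq> {1..n}}"

definition SF :: "nat \<Rightarrow> nat \<Rightarrow> 'k::field mpol set \<Rightarrow> 'k mpol set" where
  "SF n l J =
     Idl\<^bsub>polynomial_ring n\<^esub>
       (squarefree_monomials n \<inter> symbolic_power (polynomial_ring n) J l)"

end

theory Submission
  imports Defs
begin

text \<open>
  Let \<open>\<B>\<close> be the set of complements of the bases of the matroid, so that
  \<open>J\<^sup>(\<^sup>l\<^sup>)\<close> is spanned by the monomials \<open>x\<^sup>m\<close> whose weight \<open>\<Sum>i\<in>B. m\<^sub>i\<close> is at least \<open>l\<close> for
  every \<open>B \<in> \<B>\<close>. Write \<open>x\<^sup>m\<close> as the product of the squarefree monomials supported on the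
  nested sets \<open>C\<^sub>j = {i. m\<^sub>i > j}\<close>. By the greedy property of matroids some basis meets all
  \<open>C\<^sub>j\<close> in the largest possible number of elements at once, so its complement minimises every
  \<open>card (C\<^sub>j \<inter> B)\<close> simultaneously. Hence the symbolic orders of the squarefree factors add up
  to the minimal weight of \<open>m\<close>, which is at least \<open>l\<close>; surplus \<open>t\<close>-degree is discarded by
  lowering the degrees of individual factors. Each order is at most the common cardinality of
  the sets in \<open>\<B>\<close>, and this is at most the height of \<open>J\<close> because below each
  \<open>\<pp>\<^sub>B\<close> there is a chain of primes obtained by adding the variables one by one.
\<close>

section \<open>Powers of monomial primes\<close>

lemma poly_mapping_sum_single:
  "(\<Sum>m\<in>Poly_Mapping.keys f. Poly_Mapping.single m (Poly_Mapping.lookup f m)) = f"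
  by (rule poly_mapping_eqI) (simp add: lookup_sum lookup_single sum.delta when_def in_keys_iff cong: if_cong)

text \<open>A polynomial is the finite sum of its terms. Membership in any additively closed set can
  therefore be tested term by term; all later inclusions between monomial ideals and subalgebras
  rest on this.\<close>

lemma poly_mapping_additive_closure:
  fixes f :: "'a \<Rightarrow>\<^sub>0 'b::comm_monoid_add"
  assumes "0 \<in> S" and "\<And>f g. f \<in> S \<Longrightarrow> g \<in> S \<Longrightarrow> f + g \<in> S"
    and "\<And>m. m \<in> Poly_Mapping.keys f \<Longrightarrow> Poly_Mapping.single m (Poly_Mapping.lookup f m) \<in> S"
  shows "f \<in> S"
proof -
  have "(\<Sum>m\<in>K. Poly_Mapping.single m (Poly_Mapping.lookup f m)) \<in> S"
    if "finite K" "K \<subseteq> Poly_Mapping.keys f" for K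
    using that by (induction K rule: finite_induct) (auto intro: assms)
  from this[of "Poly_Mapping.keys f"] show ?thesis
    by (simp add: poly_mapping_sum_single)
qed

text \<open>For finite \<open>B\<close> this is the order of the monomial \<open>x^m\<close> along
  the prime generated by the variables with index in \<open>B\<close>.\<close>

definition weight :: "nat set \<Rightarrow> (nat \<Rightarrow>\<^sub>0 nat) \<Rightarrow> nat" where
  "weight B m = (\<Sum>i\<in>B. Poly_Mapping.lookup m i)"

lemma weight_add: "weight B (m + m') = weight B m + weight B m'"
  by (simp add: weight_def lookup_add sum.distrib)

lemma weight_pos_iff: "finite B \<Longrightarrow> 0 < weight B m \<longleftrightarrow> (\<exists>i\<in>B. 0 < Poly_Mapping.lookup m i)"
  by (auto simp: weight_def sum_pos2 intro: ccontr)

definition squarefree_exponent :: "nat set \<Rightarrow> nat \<Rightarrow>\<^sub>0 nat" where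
  "squarefree_exponent A = (\<Sum>i\<in>A. Poly_Mapping.single i 1)"

lemma lookup_squarefree_exponent:
  "finite A \<Longrightarrow> Poly_Mapping.lookup (squarefree_exponent A) i = (if i \<in> A then 1 else 0)"
  by (simp add: squarefree_exponent_def lookup_sum lookup_single when_def)

lemma keys_squarefree_exponent: "finite A \<Longrightarrow> Poly_Mapping.keys (squarefree_exponent A) = A"
  by (auto simp: in_keys_iff lookup_squarefree_exponent split: if_splits)

lemma weight_squarefree_exponent:
  "finite A \<Longrightarrow> finite B \<Longrightarrow> weight B (squarefree_exponent A) = card (A \<inter> B)"
  by (simp add: weight_def lookup_squarefree_exponent sum.If_cases Int_commute)

lemma prod_indet:
  "finite A \<Longrightarrow> (\<Prod>i\<in>A. indet i) = (Poly_Mapping.single (squarefree_exponent A) 1 :: 'k::field mpol)"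
  by (induction A rule: finite_induct)
    (simp_all add: squarefree_exponent_def indet_def mult_single)

text \<open>Peeling one variable of \<open>B\<close> off a term lowers its weight by one; this
  drives both the description of the prime itself and the induction on its powers.\<close>

lemma single_factor_indet:
  assumes "0 < Poly_Mapping.lookup m i"
  obtains m' where "m = m' + Poly_Mapping.single i 1"
    and "Poly_Mapping.single m c = Poly_Mapping.single m' c * (indet i :: 'k::field mpol)"
proof
  show *: "m = (m - Poly_Mapping.single i 1) + Poly_Mapping.single i 1"
    using assms by (intro poly_mapping_eqI) (auto simp: lookup_add lookup_minus lookup_single when_def)
  show "Poly_Mapping.single m c
      = Poly_Mapping.single (m - Poly_Mapping.single i 1) c * (indet i :: 'k mpol)"
    unfolding indet_def mult_single using * by simp
qed

lemma keys_add_nat: "Poly_Mapping.keys (m + m' :: nat \<Rightarrow>\<^sub>0 nat) = Poly_Mapping.keys m \<union> Poly_Mapping.keys m'"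
  by (auto simp: in_keys_iff lookup_add)

section \<open>The polynomial ring and the monomial description of powers of its variable
  primes\<close>

lemma polynomial_ring_simps [simp]:
  "carrier (polynomial_ring n) = {f. \<forall>m\<in>Poly_Mapping.keys f. Poly_Mapping.keys m \<subseteq> {1..n}}"
  "f \<otimes>\<^bsub>polynomial_ring n\<^esub> g = f * g" "f \<oplus>\<^bsub>polynomial_ring n\<^esub> g = f + g"
  "\<one>\<^bsub>polynomial_ring n\<^esub> = 1" "\<zero>\<^bsub>polynomial_ring n\<^esub> = 0"
  by (simp_all add: polynomial_ring_def ring_of_type_algebra_def)

text \<open>The \<open>l\<close>-th power of the prime generated by the variables of
  \<open>B\<close>, encoded by a condition on exponents so that membership is decided on each term
  separately. The lemma \<open>var_ideal_pow\<close> identifies it with the power in the monoid of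
  ideals.\<close>

definition var_power :: "nat \<Rightarrow> nat set \<Rightarrow> nat \<Rightarrow> 'k::field mpol set" where
  "var_power n B l =
     {f. \<forall>m\<in>Poly_Mapping.keys f. Poly_Mapping.keys m \<subseteq> {1..n} \<and> l \<le> weight B m}"

lemma var_power_0: "var_power n B 0 = carrier (polynomial_ring n)"
  by (simp add: var_power_def)

lemma zero_in_var_power: "0 \<in> var_power n B l"
  by (simp add: var_power_def)

lemma var_power_add: "f \<in> var_power n B l \<Longrightarrow> g \<in> var_power n B l \<Longrightarrow> f + g \<in> var_power n B l"
  using Poly_Mapping.keys_add[of f g] by (fastforce simp: var_power_def)

lemma var_power_uminus: "f \<in> var_power n B l \<Longrightarrow> - f \<in> var_power n B l"
  by (simp add: var_power_def)

lemma var_power_mult: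
  assumes "f \<in> var_power n B k" "g \<in> var_power n B l"
  shows "f * g \<in> var_power n B (k + l)"
  unfolding var_power_def
proof (intro CollectI ballI)
  fix m assume "m \<in> Poly_Mapping.keys (f * g)"
  then obtain a b where "m = a + b" "a \<in> Poly_Mapping.keys f" "b \<in> Poly_Mapping.keys g"
    using keys_mult[of f g] by blast
  then show "Poly_Mapping.keys m \<subseteq> {1..n} \<and> k + l \<le> weight B m"
    using assms by (auto simp: var_power_def keys_add_nat weight_add intro: add_mono)
qed

lemma single_in_var_power:
  "c \<noteq> 0 \<Longrightarrow> Poly_Mapping.single m c \<in> var_power n B l
     \<longleftrightarrow> Poly_Mapping.keys m \<subseteq> {1..n} \<and> l \<le> weight B m"
  by (simp add: var_power_def)

lemma cring_polynomial_ring: "cring (polynomial_ring n :: 'k::field mpol ring)"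
proof (rule cringI)
  \<comment> \<open>The carrier is \<open>var_power n {} 0\<close>, so its closure under sums and
    products is an instance of the closure of \<open>var_power\<close>.\<close>
  note carr = var_power_0[of n "{}", symmetric]
  show "abelian_group (polynomial_ring n :: 'k mpol ring)"
  proof (rule abelian_groupI)
    fix x :: "'k mpol" assume "x \<in> carrier (polynomial_ring n)"
    then show "\<exists>y\<in>carrier (polynomial_ring n). y \<oplus>\<^bsub>polynomial_ring n\<^esub> x = \<zero>\<^bsub>polynomial_ring n\<^esub>"
      by (intro bexI[of _ "- x"]) auto
  next
    fix x y :: "'k mpol" assume "x \<in> carrier (polynomial_ring n)" "y \<in> carrier (polynomial_ring n)"
    then show "x \<oplus>\<^bsub>polynomial_ring n\<^esub> y \<in> carrier (polynomial_ring n)"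
      unfolding carr by (simp add: var_power_add)
  qed (auto simp: algebra_simps)
  show "comm_monoid (polynomial_ring n :: 'k mpol ring)"
  proof (rule comm_monoidI)
    fix x y :: "'k mpol" assume "x \<in> carrier (polynomial_ring n)" "y \<in> carrier (polynomial_ring n)"
    then show "x \<otimes>\<^bsub>polynomial_ring n\<^esub> y \<in> carrier (polynomial_ring n)"
      unfolding carr using var_power_mult[of x n "{}" 0 y 0] by simp
  qed (auto simp: algebra_simps)
qed (auto simp: algebra_simps)

lemma a_inv_polynomial_ring:
  assumes "f \<in> carrier (polynomial_ring n)"
  shows "\<ominus>\<^bsub>polynomial_ring n\<^esub> f = - f"
proof -
  interpret cring "polynomial_ring n :: 'a mpol ring" by (rule cring_polynomial_ring)
  have "- f \<in> carrier (polynomial_ring n)" using assms by simp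
  then show ?thesis using minus_equality[of "- f" f] assms by simp
qed

lemma ideal_polynomial_ringI:
  assumes "I \<subseteq> carrier (polynomial_ring n)" and "0 \<in> I"
    and "\<And>f g. f \<in> I \<Longrightarrow> g \<in> I \<Longrightarrow> f + g \<in> I"
    and "\<And>f g. f \<in> I \<Longrightarrow> g \<in> carrier (polynomial_ring n) \<Longrightarrow> g * f \<in> I"
  shows "ideal (I :: 'k::field mpol set) (polynomial_ring n)"
proof (rule idealI)
  interpret R: cring "polynomial_ring n :: 'k mpol ring" by (rule cring_polynomial_ring)
  show "ring (polynomial_ring n :: 'k mpol ring)" by (rule R.ring_axioms)
  \<comment> \<open>Negation is multiplication by the constant \<open>- 1\<close>.\<close>
  have "- f \<in> I" if "f \<in> I" for f
    using assms(4)[OF that, of "- 1"] by simp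
  then have "\<ominus>\<^bsub>polynomial_ring n\<^esub> f \<in> I" if "f \<in> I" for f
    using a_inv_polynomial_ring[OF subsetD[OF assms(1) that]] that by simp
  then show "subgroup I (add_monoid (polynomial_ring n))"
    using assms(1-3)
    by (intro R.add.subgroupI) (auto simp del: polynomial_ring_simps(1) simp flip: a_inv_def)
  fix a x :: "'k mpol" assume "a \<in> I" "x \<in> carrier (polynomial_ring n)"
  then show "x \<otimes>\<^bsub>polynomial_ring n\<^esub> a \<in> I" "a \<otimes>\<^bsub>polynomial_ring n\<^esub> x \<in> I"
    using assms(4) by (simp_all add: mult.commute)
qed

lemma ideal_var_power: "ideal (var_power n B l) (polynomial_ring n)"
proof (rule ideal_polynomial_ringI)
  fix f g :: "'a mpol" assume "f \<in> var_power n B l" "g \<in> carrier (polynomial_ring n)"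
  then show "g * f \<in> var_power n B l"
    using var_power_mult[of g n B 0 f l] by (simp add: var_power_0)
qed (auto simp: var_power_def intro: var_power_add[unfolded var_power_def] dest: subsetD[OF Poly_Mapping.keys_add])

lemma indet_in_var_power: "finite B \<Longrightarrow> i \<in> B \<Longrightarrow> B \<subseteq> {1..n} \<Longrightarrow> indet i \<in> var_power n B 1"
  by (auto simp: indet_def single_in_var_power Suc_le_eq weight_pos_iff intro!: bexI[of _ i])

text \<open>A term of positive weight is divisible by some variable of \<open>B\<close>, hence lies
  in the ideal generated by these variables.\<close>

lemma var_ideal_eq:
  assumes "B \<subseteq> {1..n}"
  shows "var_ideal n B = (var_power n B 1 :: 'k::field mpol set)"
proof
  interpret R: cring "polynomial_ring n :: 'k mpol ring" by (rule cring_polynomial_ring)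
  have fin: "finite B" using assms finite_subset by blast
  show "var_ideal n B \<subseteq> (var_power n B 1 :: 'k mpol set)"
    unfolding var_ideal_def
    by (rule R.genideal_minimal[OF ideal_var_power]) (use fin assms indet_in_var_power in auto)
  have sub: "indet ` B \<subseteq> carrier (polynomial_ring n :: 'k mpol ring)"
    using assms by (auto simp: indet_def)
  interpret I: ideal "var_ideal n B :: 'k mpol set" "polynomial_ring n"
    unfolding var_ideal_def by (rule R.genideal_ideal[OF sub])
  show "(var_power n B 1 :: 'k mpol set) \<subseteq> var_ideal n B"
  proof
    fix f :: "'k mpol" assume f: "f \<in> var_power n B 1"
    show "f \<in> var_ideal n B"
    proof (rule poly_mapping_additive_closure)
      fix m assume m: "m \<in> Poly_Mapping.keys f"
      then have k: "Poly_Mapping.keys m \<subseteq> {1..n}" and "0 < weight B m"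
        using f by (auto simp: var_power_def)
      then obtain i where i: "i \<in> B" "0 < Poly_Mapping.lookup m i"
        using fin weight_pos_iff by blast
      obtain m' where "m = m' + Poly_Mapping.single i 1" and
        eq: "Poly_Mapping.single m (Poly_Mapping.lookup f m)
          = Poly_Mapping.single m' (Poly_Mapping.lookup f m) * indet i"
        using single_factor_indet[OF i(2)] by metis
      then have "Poly_Mapping.single m' (Poly_Mapping.lookup f m) \<in> carrier (polynomial_ring n)"
        using k by (auto simp: keys_add_nat)
      moreover have "indet i \<in> (var_ideal n B :: 'k mpol set)"
        unfolding var_ideal_def using R.genideal_self[OF sub] i(1) by blast
      ultimately show "Poly_Mapping.single m (Poly_Mapping.lookup f m) \<in> var_ideal n B"
        using I.I_l_closed eq by fastforce
    qed (use I.zero_closed I.a_closed in auto)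
  qed
qed

text \<open>Induction on \<open>l\<close>. The zeroth power is the unit of the monoid of ideals, the
  whole ring; a term of weight at least \<open>Suc l\<close> is a variable of \<open>B\<close> times
  a term of weight at least \<open>l\<close>.\<close>

lemma var_ideal_pow:
  assumes "B \<subseteq> {1..n}"
  shows "var_ideal n B [^]\<^bsub>ideals_set (polynomial_ring n)\<^esub> l = (var_power n B l :: 'k::field mpol set)"
proof (induction l)
  interpret R: cring "polynomial_ring n :: 'k mpol ring" by (rule cring_polynomial_ring)
  interpret M: comm_monoid "ideals_set (polynomial_ring n :: 'k mpol ring)"
    by (rule R.ideals_set_is_comm_monoid)
  have fin: "finite B" using assms finite_subset by blast
  {
    case 0
    show ?case by (simp add: var_power_0 ideals_set_def del: polynomial_ring_simps)
  next
    case (Suc l)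
    have "ideal_prod (polynomial_ring n) (var_power n B l) (var_power n B 1)
      = (var_power n B (Suc l) :: 'k mpol set)" (is "?P = _")
    proof
      show "?P \<subseteq> var_power n B (Suc l)"
      proof
        fix f assume "f \<in> ?P"
        then show "f \<in> var_power n B (Suc l)"
          by induction (use var_power_mult[of _ n B l _ 1] in \<open>auto intro: var_power_add\<close>)
      qed
      interpret I: ideal ?P "polynomial_ring n :: 'k mpol ring"
        by (intro R.ideal_prod_is_ideal ideal_var_power)
      show "var_power n B (Suc l) \<subseteq> ?P"
      proof
        fix f :: "'k mpol" assume f: "f \<in> var_power n B (Suc l)"
        show "f \<in> ?P"
        proof (rule poly_mapping_additive_closure)
          fix m assume m: "m \<in> Poly_Mapping.keys f"
          then have k: "Poly_Mapping.keys m \<subseteq> {1..n}" and w: "Suc l \<le> weight B m"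
            using f by (auto simp: var_power_def)
          then obtain i where i: "i \<in> B" "0 < Poly_Mapping.lookup m i"
            using fin weight_pos_iff[of B m] by auto
          obtain m' where m': "m = m' + Poly_Mapping.single i 1" and
            eq: "Poly_Mapping.single m (Poly_Mapping.lookup f m)
              = Poly_Mapping.single m' (Poly_Mapping.lookup f m) * indet i"
            using single_factor_indet[OF i(2)] by metis
          have "weight B (Poly_Mapping.single i 1) = 1"
            using i(1) fin by (simp add: weight_def lookup_single when_def)
          then have "Poly_Mapping.single m' (Poly_Mapping.lookup f m) \<in> var_power n B l"
            using k w m' by (auto simp: var_power_def keys_add_nat weight_add)
          from ideal_prod.prod[OF this indet_in_var_power[OF fin i(1) assms], of "polynomial_ring n"]
          show "Poly_Mapping.single m (Poly_Mapping.lookup f m) \<in> ?P"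
            using eq by simp
        qed (use I.zero_closed I.a_closed in auto)
      qed
    qed
    then show ?case
      using Suc M.nat_pow_Suc by (simp add: ideals_set_def var_ideal_eq[OF assms] del: polynomial_ring_simps)
  }
qed

section \<open>Prime ideals, height and symbolic powers\<close>

lemma primeideal_var_power:
  assumes "B \<subseteq> {1..n}"
  shows "primeideal (var_power n B 1 :: 'k::field mpol set) (polynomial_ring n)"
proof (rule primeidealI[OF ideal_var_power cring_polynomial_ring])
  have fin: "finite B" using assms finite_subset by blast
  show "carrier (polynomial_ring n) \<noteq> (var_power n B 1 :: 'k mpol set)"
  proof
    assume "carrier (polynomial_ring n) = (var_power n B 1 :: 'k mpol set)"
    moreover have "(1 :: 'k mpol) \<in> carrier (polynomial_ring n)" by simp
    ultimately have "(1 :: 'k mpol) \<in> var_power n B 1" by metis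
    then show False by (simp add: var_power_def weight_def)
  qed
  \<comment> \<open>The part of \<open>f\<close> not involving \<open>B\<close> represents \<open>f\<close> modulo the ideal, so products of
    non-members stay non-members because polynomials form a domain.\<close>
  define free where "free f = (\<Sum>m\<in>{m \<in> Poly_Mapping.keys f. weight B m = 0}.
      Poly_Mapping.single m (Poly_Mapping.lookup f m))" for f :: "'k mpol"
  have lookup_free: "Poly_Mapping.lookup (free f) m
      = (if weight B m = 0 then Poly_Mapping.lookup f m else 0)" for f m
    by (simp add: free_def lookup_sum lookup_single when_def in_keys_iff)
  have keys_free: "m \<in> Poly_Mapping.keys (free f) \<longleftrightarrow> m \<in> Poly_Mapping.keys f \<and> weight B m = 0" for f m
    by (simp add: in_keys_iff lookup_free)
  have rest: "f - free f \<in> var_power n B 1" if "f \<in> carrier (polynomial_ring n)" for f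
    using that by (auto simp: var_power_def in_keys_iff lookup_minus lookup_free split: if_splits)
  have free_nz: "free f \<noteq> 0" if f: "f \<in> carrier (polynomial_ring n)" "f \<notin> var_power n B 1" for f
    using rest[OF f(1)] f(2) by auto
  interpret I: ideal "var_power n B 1 :: 'k mpol set" "polynomial_ring n" by (rule ideal_var_power)
  fix a b :: "'k mpol"
  assume a: "a \<in> carrier (polynomial_ring n)" and b: "b \<in> carrier (polynomial_ring n)"
    and ab: "a \<otimes>\<^bsub>polynomial_ring n\<^esub> b \<in> var_power n B 1"
  show "a \<in> var_power n B 1 \<or> b \<in> var_power n B 1"
  proof (rule ccontr)
    assume "\<not> ?thesis"
    then have nz: "free a * free b \<noteq> 0" using free_nz a b by simp
    have fa: "free a \<in> carrier (polynomial_ring n)" using a by (auto simp: keys_free)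
    have 1: "free a * (b - free b) \<in> var_power n B 1"
      using I.I_l_closed[OF rest[OF b] fa] by simp
    have 2: "b * (a - free a) \<in> var_power n B 1"
      using I.I_l_closed[OF rest[OF a] b] by simp
    have "free a * free b = a * b + - (b * (a - free a) + free a * (b - free b))"
      by (simp add: algebra_simps)
    also have "\<dots> \<in> var_power n B 1"
      using ab 1 2 by (intro var_power_add var_power_uminus) auto
    finally have mem: "free a * free b \<in> var_power n B 1" .
    \<comment> \<open>All exponents of this nonzero product have weight 0, whereas membership in the
      ideal demands weight at least 1.\<close>
    obtain m where m: "m \<in> Poly_Mapping.keys (free a * free b)"
      using nz by (metis all_not_in_conv keys_eq_empty)
    then obtain u v where "m = u + v" "u \<in> Poly_Mapping.keys (free a)" "v \<in> Poly_Mapping.keys (free b)"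
      using keys_mult[of "free a" "free b"] by blast
    then have "weight B m = 0" by (simp add: weight_add keys_free)
    then show False using mem m by (auto simp: var_power_def)
  qed
qed

lemma indet_in_var_power_iff:
  assumes "B \<subseteq> {1..n}" "i \<in> {1..n}"
  shows "(indet i :: 'k::field mpol) \<in> var_power n B 1 \<longleftrightarrow> i \<in> B"
proof -
  have "finite B" using assms finite_subset by blast
  then show ?thesis using assms(2)
    by (auto simp: indet_def single_in_var_power Suc_le_eq weight_pos_iff lookup_single when_def)
qed

lemma squarefree_in_var_power_iff:
  assumes "A \<subseteq> {1..n}" "B \<subseteq> {1..n}"
  shows "(\<Prod>i\<in>A. indet i :: 'k::field mpol) \<in> var_power n B l \<longleftrightarrow> l \<le> card (A \<inter> B)"
proof -
  have "finite A" "finite B" using assms finite_subset by blast+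
  then show ?thesis using assms(1)
    by (simp add: prod_indet single_in_var_power keys_squarefree_exponent weight_squarefree_exponent)
qed

lemma var_power_1_subset_iff:
  assumes "B \<subseteq> {1..n}" "B' \<subseteq> {1..n}"
  shows "(var_power n B 1 :: 'k::field mpol set) \<subseteq> var_power n B' 1 \<longleftrightarrow> B \<subseteq> B'"
proof
  assume sub: "(var_power n B 1 :: 'k mpol set) \<subseteq> var_power n B' 1"
  show "B \<subseteq> B'"
  proof
    fix i assume "i \<in> B"
    then show "i \<in> B'"
      using sub assms indet_in_var_power_iff[of _ n i, where 'k='k] by blast
  qed
next
  assume "B \<subseteq> B'"
  then have "weight B m \<le> weight B' m" for m
    using assms finite_subset[of B' "{1..n}"] by (auto simp: weight_def intro: sum_mono2)
  then show "(var_power n B 1 :: 'k mpol set) \<subseteq> var_power n B' 1"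
    unfolding var_power_def by (blast intro: order_trans)
qed

text \<open>Otherwise choose in each ideal an element outside \<open>P\<close>; their product lies
  in all the ideals but, \<open>P\<close> being prime, not in \<open>P\<close>. Intersecting with
  \<open>carrier R\<close> lets the statement cover the empty family, whose intersection is
  \<open>UNIV\<close>.\<close>

lemma primeideal_contains_Inter:
  assumes P: "primeideal P R" and "finite \<F>" and "\<And>I. I \<in> \<F> \<Longrightarrow> ideal I R"
    and "carrier R \<inter> \<Inter>\<F> \<subseteq> P"
  shows "\<exists>I\<in>\<F>. I \<subseteq> P"
proof (rule ccontr)
  interpret P: primeideal P R by (rule P)
  assume none: "\<not> ?thesis"
  have "\<exists>f\<in>carrier R. f \<notin> P \<and> f \<in> \<Inter>\<F>"
    using assms(2,3) none
  proof (induction \<F> rule: finite_induct)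
    case empty
    then show ?case using P.I_notcarr P.Icarr by blast
  next
    case (insert I \<F>)
    then obtain f where f: "f \<in> carrier R" "f \<notin> P" "f \<in> \<Inter>\<F>" by blast
    obtain g where g: "g \<in> I" "g \<notin> P" using insert.prems by blast
    have gc: "g \<in> carrier R" using g insert.prems ideal.Icarr by fastforce
    have "g \<otimes>\<^bsub>R\<^esub> f \<notin> P" using f g gc P.I_prime by blast
    moreover have "g \<otimes>\<^bsub>R\<^esub> f \<in> I"
      using insert.prems(1)[of I] f g ideal.I_r_closed by fastforce
    moreover have "g \<otimes>\<^bsub>R\<^esub> f \<in> I'" if "I' \<in> \<F>" for I'
      using insert.prems(1)[of I'] that f gc ideal.I_l_closed by fastforce
    ultimately show ?case using f gc by (intro bexI[of _ "g \<otimes>\<^bsub>R\<^esub> f"]) auto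
  qed
  then show False using assms(4) by blast
qed

section \<open>Lower bounds for heights from chains of variable primes\<close>

lemma prime_height_ge:
  assumes "\<And>i. i \<le> r \<Longrightarrow> primeideal (C i) R" and "\<And>i. i < r \<Longrightarrow> C i \<subset> C (Suc i)"
  shows "enat r \<le> prime_height R (C r)"
  unfolding prime_height_def using assms by (intro Sup_upper) blast

text \<open>Adding the variables of \<open>B\<close> one by one to the zero ideal gives a strictly
  increasing chain of \<open>card B + 1\<close> primes that ends below \<open>P\<close>.\<close>

lemma card_le_prime_height:
  assumes B: "B \<subseteq> {1..n}" and P: "primeideal P (polynomial_ring n)"
    and sub: "(var_power n B 1 :: 'k::field mpol set) \<subseteq> P"
  shows "enat (card B) \<le> prime_height (polynomial_ring n) P"
proof -
  have "finite B" using B finite_subset by blast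
  then obtain bs where bs: "set bs = B" "distinct bs" using finite_distinct_list by blast
  define C :: "nat \<Rightarrow> 'k mpol set" where "C i = var_power n (set (take i bs)) 1" for i
  have len: "length bs = card B" using bs distinct_card by fastforce
  have take_sub: "set (take i bs) \<subseteq> {1..n}" for i using B bs set_take_subset by fastforce
  have prime: "primeideal (C i) (polynomial_ring n)" for i
    unfolding C_def by (rule primeideal_var_power[OF take_sub])
  have strict: "C i \<subset> C (Suc i)" if "i < card B" for i
  proof -
    have "bs ! i \<notin> set (take i bs)"
      using that bs(2) len by (auto simp: in_set_conv_nth nth_eq_iff_index_eq)
    then have "set (take i bs) \<subset> set (take (Suc i) bs)"
      using that len by (auto simp: take_Suc_conv_app_nth)
    then show ?thesis
      unfolding C_def less_le_not_le var_power_1_subset_iff[OF take_sub take_sub] .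
  qed
  have last: "C (card B) = var_power n B 1" using bs len by (simp add: C_def)
  show ?thesis
  proof (cases "P = var_power n B 1")
    case True
    have "enat (card B) \<le> prime_height (polynomial_ring n) (C (card B))"
      using prime strict by (rule prime_height_ge)
    then show ?thesis unfolding last True .
  next
    case False
    \<comment> \<open>The height of \<open>P\<close> counts chains ending in \<open>P\<close>
      itself, so \<open>P\<close> is appended on top; the chain gets one step longer than
      required.\<close>
    then have proper: "C (card B) \<subset> P" using sub last by blast
    have "enat (card B) \<le> enat (Suc (card B))" by simp
    also have "\<dots> \<le> prime_height (polynomial_ring n) ((C(Suc (card B) := P)) (Suc (card B)))"
    proof (rule prime_height_ge[of "Suc (card B)" "C(Suc (card B) := P)"])
      fix i assume "i < Suc (card B)"
      then consider "i < card B" | "i = card B" by linarith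
      then show "(C(Suc (card B) := P)) i \<subset> (C(Suc (card B) := P)) (Suc i)"
        by cases (use strict proper in simp_all)
    qed (use prime P in simp)
    finally show ?thesis by simp
  qed
qed

text \<open>A prime over the finite intersection contains one of the components, and the chain below
  that component bounds its height.\<close>

lemma card_le_height_Inter:
  assumes "finite \<B>" and "\<And>B. B \<in> \<B> \<Longrightarrow> B \<subseteq> {1..n} \<and> card B = s" and "\<B> \<noteq> {}"
  shows "enat s \<le> height (polynomial_ring n) (\<Inter>B\<in>\<B>. var_power n B 1 :: 'k::field mpol set)"
  unfolding height_def
proof (rule INF_greatest)
  fix P assume "P \<in> {P. primeideal P (polynomial_ring n) \<and> (\<Inter>B\<in>\<B>. var_power n B 1 :: 'k mpol set) \<subseteq> P}"
  then have P: "primeideal P (polynomial_ring n)" "(\<Inter>B\<in>\<B>. var_power n B 1 :: 'k mpol set) \<subseteq> P"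
    by auto
  have "\<exists>I\<in>(\<lambda>B. var_power n B 1) ` \<B>. I \<subseteq> P"
    by (rule primeideal_contains_Inter[OF P(1)]) (use assms(1) P(2) ideal_var_power in auto)
  then show "enat s \<le> prime_height (polynomial_ring n) P"
    using card_le_prime_height[OF _ P(1)] assms(2) by blast
qed

text \<open>The annihilator of the class of \<open>f\<close> is the intersection of the components
  that do not contain \<open>f\<close>. If it is prime it contains, and hence equals, one of them.
  The converse needs for each component an \<open>f\<close> that avoids only this one, which the
  antichain condition provides.\<close>

lemma associated_primes_Inter:
  assumes "finite \<B>" and sub: "\<And>B. B \<in> \<B> \<Longrightarrow> B \<subseteq> {1..n}"
    and anti: "\<And>B B'. B \<in> \<B> \<Longrightarrow> B' \<in> \<B> \<Longrightarrow> B \<subseteq> B' \<Longrightarrow> B = B'"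
    and ne: "\<B> \<noteq> {}"
  shows "associated_primes (polynomial_ring n) (\<Inter>B\<in>\<B>. var_power n B 1 :: 'k::field mpol set)
    = (\<lambda>B. var_power n B 1) ` \<B>"
proof -
  let ?J = "\<Inter>B\<in>\<B>. var_power n B 1 :: 'k mpol set"
  define colon where "colon f = {r \<in> carrier (polynomial_ring n). r * f \<in> ?J}" for f
  have mult_iff: "r * f \<in> var_power n B 1 \<longleftrightarrow> r \<in> var_power n B 1 \<or> f \<in> var_power n B 1"
    if "B \<in> \<B>" "r \<in> carrier (polynomial_ring n)" "f \<in> carrier (polynomial_ring n)"
    for r f :: "'k mpol" and B
  proof -
    interpret I: primeideal "var_power n B 1 :: 'k mpol set" "polynomial_ring n"
      using primeideal_var_power[OF sub] that by blast
    show ?thesis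
      using that I.I_prime[of r f] I.I_l_closed[of f r] I.I_r_closed[of r f] by auto
  qed
  \<comment> \<open>A component containing \<open>f\<close> puts no condition on \<open>r\<close>;
    any other one forces \<open>r\<close> into itself by primeness.\<close>
  have colon: "colon f = carrier (polynomial_ring n) \<inter> (\<Inter>B\<in>{B\<in>\<B>. f \<notin> var_power n B 1}. var_power n B 1)"
    if "f \<in> carrier (polynomial_ring n)" for f
    unfolding colon_def using mult_iff that by (auto simp del: polynomial_ring_simps)
  show ?thesis
  proof (intro equalityI subsetI)
    fix P assume "P \<in> associated_primes (polynomial_ring n) ?J"
    then obtain f where P: "primeideal P (polynomial_ring n)"
      and f: "f \<in> carrier (polynomial_ring n)" and Pf: "P = colon f"
      unfolding associated_primes_def colon_def by auto
    have "\<exists>I\<in>(\<lambda>B. var_power n B 1) ` {B\<in>\<B>. f \<notin> var_power n B 1}. I \<subseteq> P"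
      by (rule primeideal_contains_Inter[OF P])
        (use assms(1) ideal_var_power colon[OF f] Pf in auto)
    then show "P \<in> (\<lambda>B. var_power n B 1) ` \<B>"
      using colon[OF f] Pf by blast
  next
    fix P :: "'k mpol set" assume "P \<in> (\<lambda>B. var_power n B 1) ` \<B>"
    then obtain B where B: "B \<in> \<B>" and P: "P = var_power n B 1" by blast
    \<comment> \<open>The product of the variables outside \<open>B\<close> avoids the component of
      \<open>B'\<close> exactly when \<open>B' \<subseteq> B\<close>, which in an antichain means
      \<open>B' = B\<close>.\<close>
    let ?f = "\<Prod>i\<in>{1..n} - B. indet i :: 'k mpol"
    have f: "?f \<in> carrier (polynomial_ring n)"
      by (auto simp: prod_indet keys_squarefree_exponent)
    have "?f \<notin> var_power n B' 1 \<longleftrightarrow> B' = B" if "B' \<in> \<B>" for B'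
    proof -
      have "?f \<notin> var_power n B' 1 \<longleftrightarrow> ({1..n} - B) \<inter> B' = {}"
        using squarefree_in_var_power_iff[of "{1..n} - B" n B' 1, where 'k='k] sub[OF that]
        by (auto simp: card_gt_0_iff Suc_le_eq)
      also have "\<dots> \<longleftrightarrow> B' \<subseteq> B" using sub[OF that] by blast
      finally show ?thesis using anti[OF that B] by blast
    qed
    then have "{B'\<in>\<B>. ?f \<notin> var_power n B' 1} = {B}" using B by blast
    then have "P = colon ?f"
      using colon[OF f] P by (auto simp: var_power_def)
    then show "P \<in> associated_primes (polynomial_ring n) ?J"
      unfolding associated_primes_def colon_def
      using P primeideal_var_power[OF sub[OF B], where 'k='k] f by (auto simp del: polynomial_ring_simps(1))
  qed
qed

lemma symbolic_power_Inter:
  assumes "finite \<B>" and sub: "\<And>B. B \<in> \<B> \<Longrightarrow> B \<subseteq> {1..n}"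
    and anti: "\<And>B B'. B \<in> \<B> \<Longrightarrow> B' \<in> \<B> \<Longrightarrow> B \<subseteq> B' \<Longrightarrow> B = B'"
    and ne: "\<B> \<noteq> {}"
  shows "symbolic_power (polynomial_ring n) (\<Inter>B\<in>\<B>. var_power n B 1 :: 'k::field mpol set) l
    = (\<Inter>B\<in>\<B>. var_power n B l)"
proof -
  have pow: "var_power n B 1 [^]\<^bsub>ideals_set (polynomial_ring n)\<^esub> l = (var_power n B l :: 'k mpol set)"
    if "B \<in> \<B>" for B
    using var_ideal_pow[OF sub[OF that], of l, where 'k='k] var_ideal_eq[OF sub[OF that], where 'k='k]
    by simp
  have "(\<Inter>B\<in>\<B>. var_power n B l) \<subseteq> carrier (polynomial_ring n :: 'k mpol ring)"
    using ne by (auto simp: var_power_def)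
  moreover have "symbolic_power (polynomial_ring n) (\<Inter>B\<in>\<B>. var_power n B 1 :: 'k mpol set) l
    = {f \<in> carrier (polynomial_ring n). \<forall>B\<in>\<B>. f \<in> var_power n B 1 [^]\<^bsub>ideals_set (polynomial_ring n)\<^esub> l}"
    using associated_primes_Inter[OF assms, where 'k='k] by (simp only: symbolic_power_def ball_simps)
  ultimately show ?thesis using pow by blast
qed

section \<open>Optimal bases of matroids\<close>

lemma matroid_finite: "matroid E \<Delta> \<Longrightarrow> I \<in> \<Delta> \<Longrightarrow> finite I"
  by (auto simp: matroid_def intro: finite_subset[of I E])

lemma matroid_card_le_facet:
  assumes M: "matroid E \<Delta>" and F: "F \<in> facets \<Delta>" and G: "G \<in> \<Delta>"
  shows "card G \<le> card F"
proof (rule ccontr)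
  assume "\<not> card G \<le> card F"
  then obtain b where "b \<in> G - F" "insert b F \<in> \<Delta>"
    using M F G unfolding matroid_def facets_def by (metis (no_types, lifting) mem_Collect_eq not_le)
  then show False using F unfolding facets_def by blast
qed

lemma matroid_card_facets_eq:
  assumes "matroid E \<Delta>" "F \<in> facets \<Delta>" "G \<in> facets \<Delta>"
  shows "card F = card G"
  using matroid_card_le_facet[OF assms(1)] assms(2,3) by (simp add: facets_def le_antisym)

text \<open>The greedy step: take a largest independent set between \<open>I\<close> and
  \<open>Y\<close>. A larger independent subset of \<open>Y\<close> would enlarge it by the exchange
  axiom.\<close>

lemma matroid_extend:
  assumes M: "matroid E \<Delta>" and I: "I \<in> \<Delta>" "I \<subseteq> Y"
  obtains I' where "I' \<in> \<Delta>" "I \<subseteq> I'" "I' \<subseteq> Y" "\<And>K. K \<in> \<Delta> \<Longrightarrow> card (K \<inter> Y) \<le> card I'"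
proof -
  have fin: "finite E" and sub: "\<Delta> \<subseteq> Pow E" using M by (auto simp: matroid_def)
  define S where "S = {K \<in> \<Delta>. I \<subseteq> K \<and> K \<subseteq> Y}"
  have "finite S" "S \<noteq> {}"
    using fin sub I finite_subset[of S "Pow E"] by (auto simp: S_def)
  then have "Max (card ` S) \<in> card ` S" by (intro Max_in) auto
  then obtain I' where I': "I' \<in> S" and "card I' = Max (card ` S)" by auto
  then have max: "card K \<le> card I'" if "K \<in> S" for K
    using \<open>finite S\<close> that by simp
  have "card (K \<inter> Y) \<le> card I'" if K: "K \<in> \<Delta>" for K
  proof (rule ccontr)
    assume "\<not> ?thesis"
    \<comment> \<open>Exchanging against \<open>K \<inter> Y\<close> rather than \<open>K\<close>
      keeps the new element inside \<open>Y\<close>.\<close>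
    moreover have "K \<inter> Y \<in> \<Delta>" using M K unfolding matroid_def by (meson inf_le1)
    ultimately obtain b where b: "b \<in> K \<inter> Y - I'" "insert b I' \<in> \<Delta>"
      using M I' unfolding matroid_def S_def by (metis (no_types, lifting) mem_Collect_eq not_le)
    then have "insert b I' \<in> S" using I' by (auto simp: S_def)
    moreover have "finite I'" using I' matroid_finite[OF M] by (auto simp: S_def)
    ultimately show False using max[of "insert b I'"] b by simp
  qed
  then show ?thesis using that[of I'] I' by (auto simp: S_def)
qed

text \<open>The greedy algorithm along a decreasing chain, started at the innermost set
  \<open>C N\<close> and moving outwards with \<open>k\<close>. Each step only enlarges the
  independent set, so the optimality already reached on the inner sets survives.\<close>

lemma matroid_optimal_on_chain:
  assumes M: "matroid E \<Delta>" and dec: "\<And>j. C (Suc j) \<subseteq> C j"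
  shows "\<exists>I\<in>\<Delta>. I \<subseteq> C (N - k) \<and>
    (\<forall>j. N - k \<le> j \<and> j \<le> N \<longrightarrow> (\<forall>K\<in>\<Delta>. card (K \<inter> C j) \<le> card (I \<inter> C j)))"
proof (induction k)
  case 0
  obtain I where "I \<in> \<Delta>" "I \<subseteq> C N" "\<And>K. K \<in> \<Delta> \<Longrightarrow> card (K \<inter> C N) \<le> card I"
    using matroid_extend[OF M, of "{}" "C N"] M unfolding matroid_def by (metis empty_subsetI)
  then show ?case by (intro bexI[of _ I]) (auto simp: Int_absorb2 le_antisym)
next
  case (Suc k)
  show ?case
  proof (cases "k < N")
    \<comment> \<open>Here truncated subtraction makes \<open>N - k\<close> and
      \<open>N - Suc k\<close> both 0, so the claim does not change.\<close>
    case False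
    then show ?thesis using Suc by simp
  next
    case True
    then have N: "N - k = Suc (N - Suc k)" by simp
    obtain I where I: "I \<in> \<Delta>" "I \<subseteq> C (N - k)"
      and opt: "\<And>j K. N - k \<le> j \<Longrightarrow> j \<le> N \<Longrightarrow> K \<in> \<Delta> \<Longrightarrow> card (K \<inter> C j) \<le> card (I \<inter> C j)"
      using Suc by blast
    have "I \<subseteq> C (N - Suc k)" using I(2) N dec by (metis order_trans)
    then obtain I' where I': "I' \<in> \<Delta>" "I \<subseteq> I'" "I' \<subseteq> C (N - Suc k)"
      "\<And>K. K \<in> \<Delta> \<Longrightarrow> card (K \<inter> C (N - Suc k)) \<le> card I'"
      using matroid_extend[OF M I(1)] by metis
    have fin: "finite I'" by (rule matroid_finite[OF M I'(1)])
    have "card (K \<inter> C j) \<le> card (I' \<inter> C j)" if j: "N - Suc k \<le> j" "j \<le> N" and K: "K \<in> \<Delta>" for j K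
    proof (cases "j = N - Suc k")
      case True
      then show ?thesis using I'(4)[OF K] I'(3) by (simp add: Int_absorb2)
    next
      case False
      then have "card (K \<inter> C j) \<le> card (I \<inter> C j)" using opt[OF _ j(2) K] j(1) by simp
      also have "\<dots> \<le> card (I' \<inter> C j)" using fin I'(2) by (intro card_mono) auto
      finally show ?thesis .
    qed
    then show ?thesis using I' by blast
  qed
qed

text \<open>Taking \<open>k = N\<close> in the greedy algorithm covers the whole chain. Completing
  the resulting set to a basis, by extension inside \<open>UNIV\<close>, can only enlarge its
  intersections with the \<open>C j\<close>.\<close>

lemma matroid_facet_optimal_on_chain:
  assumes M: "matroid E \<Delta>" and dec: "\<And>j. C (Suc j) \<subseteq> C j"
  obtains F where "F \<in> facets \<Delta>"
    "\<And>j K. j \<le> N \<Longrightarrow> K \<in> \<Delta> \<Longrightarrow> card (K \<inter> C j) \<le> card (F \<inter> C j)"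
proof -
  obtain I where I: "I \<in> \<Delta>"
    and opt: "\<And>j K. j \<le> N \<Longrightarrow> K \<in> \<Delta> \<Longrightarrow> card (K \<inter> C j) \<le> card (I \<inter> C j)"
    using matroid_optimal_on_chain[OF M, of C N N] dec by auto
  obtain F where F: "F \<in> \<Delta>" "I \<subseteq> F" "\<And>K. K \<in> \<Delta> \<Longrightarrow> card (K \<inter> UNIV) \<le> card F"
    using matroid_extend[OF M I, of UNIV] by (metis subset_UNIV)
  note fin = matroid_finite[OF M]
  have "F = G" if "G \<in> \<Delta>" "F \<subseteq> G" for G
    using card_seteq[OF fin[OF that(1)] that(2)] F(3)[OF that(1)] by simp
  then have "F \<in> facets \<Delta>" unfolding facets_def using F(1) by blast
  moreover have "card (K \<inter> C j) \<le> card (F \<inter> C j)" if "j \<le> N" "K \<in> \<Delta>" for j K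
    using opt[OF that] card_mono[of "F \<inter> C j" "I \<inter> C j"] F(2) fin[OF F(1)]
    by (meson Int_mono finite_Int order_refl order_trans)
  ultimately show ?thesis using that by blast
qed

section \<open>Layers of an exponent vector and the squarefree factorisation of a monomial\<close>

definition level :: "(nat \<Rightarrow>\<^sub>0 nat) \<Rightarrow> nat \<Rightarrow> nat set" where
  "level m j = {i. j < Poly_Mapping.lookup m i}"

lemma level_subset_keys: "level m j \<subseteq> Poly_Mapping.keys m"
  by (auto simp: level_def in_keys_iff)

lemma card_less_bound: "a \<le> N \<Longrightarrow> card {j. j < N \<and> j < a} = a" for a N :: nat
proof -
  assume "a \<le> N"
  then have "{j. j < N \<and> j < a} = {..<a}" by auto
  then show ?thesis by simp
qed

text \<open>Double counting: an index \<open>i\<close> of \<open>B\<close> belongs to the levels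
  \<open>j < lookup m i\<close>, and \<open>N\<close> is large enough to include them all.\<close>

lemma weight_eq_sum_level:
  assumes "finite B" and bound: "\<And>i. Poly_Mapping.lookup m i \<le> N"
  shows "weight B m = (\<Sum>j<N. card (level m j \<inter> B))"
proof -
  have "(\<Sum>j<N. card (level m j \<inter> B)) = (\<Sum>j<N. \<Sum>i\<in>B. if j < Poly_Mapping.lookup m i then 1 else 0)"
  proof (rule sum.cong[OF refl])
    fix j
    have "level m j \<inter> B = B \<inter> {i. j < Poly_Mapping.lookup m i}" by (auto simp: level_def)
    then show "card (level m j \<inter> B) = (\<Sum>i\<in>B. if j < Poly_Mapping.lookup m i then 1 else 0)"
      using assms(1) by (simp add: sum.If_cases)
  qed
  also have "\<dots> = (\<Sum>i\<in>B. \<Sum>j<N. if j < Poly_Mapping.lookup m i then 1 else 0)"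
    by (rule sum.swap)
  also have "\<dots> = weight B m"
    using card_less_bound[OF bound] by (simp add: weight_def sum.If_cases Int_def)
  finally show ?thesis by simp
qed

lemma exponent_eq_sum_level:
  assumes bound: "\<And>i. Poly_Mapping.lookup m i \<le> N"
  shows "m = (\<Sum>j<N. squarefree_exponent (level m j))"
proof (rule poly_mapping_eqI)
  fix i
  have fin: "finite (level m j)" for j
    using level_subset_keys finite_keys by (rule finite_subset)
  have level: "Poly_Mapping.lookup (squarefree_exponent (level m j)) i
      = (if j < Poly_Mapping.lookup m i then 1 else 0)" for j
    by (simp add: lookup_squarefree_exponent[OF fin]) (simp add: level_def)
  show "Poly_Mapping.lookup m i = Poly_Mapping.lookup (\<Sum>j<N. squarefree_exponent (level m j)) i"
    using card_less_bound[OF bound[of i]]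
    by (simp add: lookup_sum level sum.If_cases Int_def)
qed

text \<open>The number \<open>d j\<close> is the symbolic order of the \<open>j\<close>-th
  squarefree factor. One basis attains all these minima at once, so they sum to the weight of
  \<open>m\<close> on its complement, which \<open>wt\<close> bounds below by
  \<open>l\<close>.\<close>

lemma matroid_level_decomposition:
  assumes M: "matroid E \<Delta>" and m: "Poly_Mapping.keys m \<subseteq> E"
    and bound: "\<And>i. Poly_Mapping.lookup m i \<le> N"
    and wt: "\<And>F. F \<in> facets \<Delta> \<Longrightarrow> l \<le> weight (E - F) m"
  obtains d where "l \<le> (\<Sum>j<N. d j)"
    and "\<And>j F. j < N \<Longrightarrow> F \<in> facets \<Delta> \<Longrightarrow> d j \<le> card (level m j \<inter> (E - F))"
    and "\<And>j F. F \<in> facets \<Delta> \<Longrightarrow> d j \<le> card (E - F)"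
proof -
  have E: "finite E" "\<Delta> \<subseteq> Pow E" using M by (auto simp: matroid_def)
  have fsub: "F \<subseteq> E" if "F \<in> facets \<Delta>" for F using that E by (auto simp: facets_def)
  have "level m (Suc j) \<subseteq> level m j" for j by (auto simp: level_def)
  then obtain F where F: "F \<in> facets \<Delta>"
    and opt: "\<And>j K. j \<le> N \<Longrightarrow> K \<in> \<Delta> \<Longrightarrow> card (K \<inter> level m j) \<le> card (F \<inter> level m j)"
    using matroid_facet_optimal_on_chain[OF M, of "level m" N] by metis
  define d where "d j = card (level m j \<inter> (E - F))" for j
  have lev: "level m j \<subseteq> E" for j using level_subset_keys m by blast
  \<comment> \<open>Passing to complements: a largest intersection of a level with a basis means a
    smallest one with its complement.\<close>
  have split: "card (level m j \<inter> (E - G)) + card (G \<inter> level m j) = card (level m j)"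
    if "G \<in> facets \<Delta>" for G j
  proof -
    have "level m j = (level m j \<inter> (E - G)) \<union> (G \<inter> level m j)" using lev by blast
    moreover have "finite (level m j)" using lev E finite_subset by blast
    ultimately show ?thesis
      using card_Un_disjoint[of "level m j \<inter> (E - G)" "G \<inter> level m j"] by fastforce
  qed
  show ?thesis
  proof
    show "l \<le> (\<Sum>j<N. d j)"
      using wt[OF F] weight_eq_sum_level[of "E - F" m N, OF _ bound] E by (simp add: d_def)
  next
    fix j G assume j: "j < N" and G: "G \<in> facets \<Delta>"
    have "card (G \<inter> level m j) \<le> card (F \<inter> level m j)"
      using opt[of j G] j G by (auto simp: facets_def)
    then show "d j \<le> card (level m j \<inter> (E - G))"
      using split[OF F, of j] split[OF G, of j] unfolding d_def by linarith
  next
    fix j G assume G: "G \<in> facets \<Delta>"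
    have "card (E - F) = card (E - G)"
      using matroid_card_facets_eq[OF M F G] fsub[OF F] fsub[OF G] E(1)
      by (simp add: card_Diff_subset finite_subset[of _ E])
    moreover have "d j \<le> card (E - F)" unfolding d_def using E by (intro card_mono) auto
    ultimately show "d j \<le> card (E - G)" by simp
  qed
qed

section \<open>The symbolic Rees algebra\<close>

lemma (in ring) additive_subgroup_finsum:
  assumes "additive_subgroup H R" "finite A" "\<And>i. i \<in> A \<Longrightarrow> f i \<in> H"
  shows "(\<Oplus>i\<in>A. f i) \<in> H"
proof -
  interpret H: additive_subgroup H R by (rule assms(1))
  show ?thesis
    using assms(2,3)
  proof (induction A rule: finite_induct)
    case empty
    then show ?case by simp
  next
    case (insert i A)
    then have "f \<in> A \<rightarrow> carrier R" "f i \<in> carrier R" using H.a_Hcarr by auto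
    then show ?case using insert by simp
  qed
qed

text \<open>The coefficient of \<open>t^l\<close> in a product is a sum of products whose degrees
  add up to \<open>l\<close>. Applied to the symbolic powers, this shows that the symbolic Rees
  algebra is a subring.\<close>

lemma (in UP_cring) subring_filtration:
  assumes ideal: "\<And>l. ideal (S l) R" and one: "\<one> \<in> S 0"
    and mult: "\<And>k l a b. a \<in> S k \<Longrightarrow> b \<in> S l \<Longrightarrow> a \<otimes> b \<in> S (k + l)"
  shows "subring {f \<in> carrier P. \<forall>l. up_ring.coeff P f l \<in> S l} P"
proof (rule P.subringI)
  have sub: "additive_subgroup (S l) R" for l using ideal by (rule ideal.axioms)
  show "\<one>\<^bsub>P\<^esub> \<in> {f \<in> carrier P. \<forall>l. up_ring.coeff P f l \<in> S l}"
    using one additive_subgroup.zero_closed[OF sub] by simp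
  fix f g assume f: "f \<in> {f \<in> carrier P. \<forall>l. up_ring.coeff P f l \<in> S l}"
  then show "\<ominus>\<^bsub>P\<^esub> f \<in> {f \<in> carrier P. \<forall>l. up_ring.coeff P f l \<in> S l}"
    using additive_subgroup.a_inv_closed[OF sub] by simp
  assume g: "g \<in> {f \<in> carrier P. \<forall>l. up_ring.coeff P f l \<in> S l}"
  show "f \<oplus>\<^bsub>P\<^esub> g \<in> {f \<in> carrier P. \<forall>l. up_ring.coeff P f l \<in> S l}"
    using f g additive_subgroup.a_closed[OF sub] by simp
  have "up_ring.coeff P f i \<otimes> up_ring.coeff P g (l - i) \<in> S l" if "i \<le> l" for i l
    using mult[of "up_ring.coeff P f i" i "up_ring.coeff P g (l - i)" "l - i"] f g that by simp
  then have "(\<Oplus>i\<in>{..l}. up_ring.coeff P f i \<otimes> up_ring.coeff P g (l - i)) \<in> S l" for l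
    by (intro R.additive_subgroup_finsum[OF sub]) auto
  then show "f \<otimes>\<^bsub>P\<^esub> g \<in> {f \<in> carrier P. \<forall>l. up_ring.coeff P f l \<in> S l}"
    using f g by simp
qed auto

text \<open>A polynomial in \<open>t\<close> is the sum of its homogeneous parts, so containment is
  reduced to elements of the form \<open>h t^l\<close>.\<close>

lemma (in UP_cring) subring_contains_if_monoms:
  assumes "subring H P" "f \<in> carrier P" "\<And>l. up_ring.monom P (up_ring.coeff P f l) l \<in> H"
  shows "f \<in> H"
proof -
  have "additive_subgroup H P"
    using subring.axioms(1)[OF assms(1)] by (simp add: additive_subgroup_def)
  then have "(\<Oplus>\<^bsub>P\<^esub>i\<in>{..deg R f}. up_ring.monom P (up_ring.coeff P f i) i) \<in> H"
    using assms(3) by (intro P.additive_subgroup_finsum) auto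
  then show ?thesis using up_repr[OF assms(2)] by simp
qed

text \<open>For a matroid on \<open>{1..n}\<close> these are the bases of the dual matroid.\<close>

definition cobases :: "nat \<Rightarrow> nat set set \<Rightarrow> nat set set" where
  "cobases n \<Delta> = (\<lambda>F. {1..n} - F) ` facets \<Delta>"

lemma facet_subset: "matroid E \<Delta> \<Longrightarrow> F \<in> facets \<Delta> \<Longrightarrow> F \<subseteq> E"
  by (auto simp: matroid_def facets_def)

text \<open>The constant empty chain already makes the greedy algorithm produce a basis.\<close>

lemma facets_nonempty: "matroid E \<Delta> \<Longrightarrow> facets \<Delta> \<noteq> {}"
  using matroid_facet_optimal_on_chain[of E \<Delta> "\<lambda>_. {}"] by blast

lemma finite_cobases: "matroid {1..n} \<Delta> \<Longrightarrow> finite (cobases n \<Delta>)"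
  using finite_subset[of \<Delta> "Pow {1..n}"] by (simp add: cobases_def facets_def matroid_def)

lemma cobases_subset: "B \<in> cobases n \<Delta> \<Longrightarrow> B \<subseteq> {1..n}"
  by (auto simp: cobases_def)

lemma cobases_nonempty: "matroid {1..n} \<Delta> \<Longrightarrow> cobases n \<Delta> \<noteq> {}"
  using facets_nonempty by (simp add: cobases_def)

lemma card_cobases_eq:
  assumes M: "matroid {1..n} \<Delta>" and "B \<in> cobases n \<Delta>" "B' \<in> cobases n \<Delta>"
  shows "card B = card B'"
proof -
  obtain F F' where "F \<in> facets \<Delta>" "F' \<in> facets \<Delta>" "B = {1..n} - F" "B' = {1..n} - F'"
    using assms(2,3) by (auto simp: cobases_def)
  then show ?thesis
    using facet_subset[OF M] matroid_card_facets_eq[OF M, of F F']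
    by (simp add: card_Diff_subset finite_subset[of _ "{1..n}"])
qed

lemma cobases_antichain:
  assumes M: "matroid {1..n} \<Delta>" and "B \<in> cobases n \<Delta>" "B' \<in> cobases n \<Delta>" "B \<subseteq> B'"
  shows "B = B'"
  using card_cobases_eq[OF assms(1-3)] assms(4) finite_subset[OF cobases_subset[OF assms(3)]]
  by (simp add: card_subset_eq)

section \<open>Stanley-Reisner ideals: symbolic powers, height and squarefree parts\<close>

lemma Stanley_Reisner_ideal_eq_Inter:
  "Stanley_Reisner_ideal n \<Delta> = (\<Inter>B\<in>cobases n \<Delta>. var_power n B 1 :: 'k::field mpol set)"
  by (simp add: Stanley_Reisner_ideal_def cobases_def var_ideal_eq)

lemma symbolic_power_Stanley_Reisner:
  assumes "matroid {1..n} \<Delta>"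
  shows "symbolic_power (polynomial_ring n) (Stanley_Reisner_ideal n \<Delta>) l
    = (\<Inter>B\<in>cobases n \<Delta>. var_power n B l :: 'k::field mpol set)"
  unfolding Stanley_Reisner_ideal_eq_Inter
  using finite_cobases[OF assms] cobases_subset cobases_antichain[OF assms] cobases_nonempty[OF assms]
  by (rule symbolic_power_Inter)

lemma card_cobase_le_height:
  assumes M: "matroid {1..n} \<Delta>" and B: "B \<in> cobases n \<Delta>"
  shows "enat (card B) \<le> height (polynomial_ring n) (Stanley_Reisner_ideal n \<Delta> :: 'k::field mpol set)"
  unfolding Stanley_Reisner_ideal_eq_Inter
  using finite_cobases[OF M] _ cobases_nonempty[OF M]
  by (rule card_le_height_Inter) (use cobases_subset card_cobases_eq[OF M _ B] in blast)

lemma ideal_Inter_var_power: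
  assumes "\<B> \<noteq> {}"
  shows "ideal (\<Inter>B\<in>\<B>. var_power n B l :: 'k::field mpol set) (polynomial_ring n)"
proof -
  interpret R: cring "polynomial_ring n :: 'k mpol ring" by (rule cring_polynomial_ring)
  show ?thesis using assms ideal_var_power by (intro R.i_Intersect) auto
qed

lemma ideal_SF: "ideal (SF n l J :: 'k::field mpol set) (polynomial_ring n)"
proof -
  interpret R: cring "polynomial_ring n :: 'k mpol ring" by (rule cring_polynomial_ring)
  show ?thesis unfolding SF_def by (rule R.genideal_ideal) (auto simp: symbolic_power_def)
qed

lemma squarefree_monomial_in_SF:
  assumes "A \<subseteq> {1..n}" "(\<Prod>i\<in>A. indet i) \<in> symbolic_power (polynomial_ring n) J l"
  shows "(\<Prod>i\<in>A. indet i :: 'k::field mpol) \<in> SF n l J"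
proof -
  interpret R: cring "polynomial_ring n :: 'k mpol ring" by (rule cring_polynomial_ring)
  have "squarefree_monomials n \<inter> symbolic_power (polynomial_ring n) J l \<subseteq> carrier (polynomial_ring n)"
    by (auto simp: symbolic_power_def)
  from R.genideal_self[OF this] show ?thesis
    using assms by (auto simp: SF_def squarefree_monomials_def)
qed

lemma SF_subset:
  assumes "ideal (symbolic_power (polynomial_ring n) J l) (polynomial_ring n :: 'k::field mpol ring)"
  shows "SF n l J \<subseteq> symbolic_power (polynomial_ring n) J l"
proof -
  interpret R: cring "polynomial_ring n :: 'k mpol ring" by (rule cring_polynomial_ring)
  show ?thesis unfolding SF_def by (rule R.genideal_minimal[OF assms]) simp
qed

text \<open>Here \<open>c\<close> is any bound for the size of the cobases; the height is
  substituted later. The substantial inclusion is checked on single terms times \<open>t^l\<close>,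
  which are factored into squarefree monomials among which the degree \<open>l\<close> is
  distributed.\<close>

lemma symbolic_rees_Stanley_Reisner:
  assumes M: "matroid {1..n} \<Delta>" and J: "J = (Stanley_Reisner_ideal n \<Delta> :: 'k::field mpol set)"
    and c: "\<And>B. B \<in> cobases n \<Delta> \<Longrightarrow> card B \<le> c"
    and G: "G = times_t_power (polynomial_ring n) J 1 \<union>
              (\<Union>l\<in>{2..c}. times_t_power (polynomial_ring n) (SF n l J) l)"
  shows "symbolic_rees (polynomial_ring n) J = adjoin (polynomial_ring n) G"
    and "G \<subseteq> symbolic_rees (polynomial_ring n) J"
proof -
  let ?R = "polynomial_ring n :: 'k mpol ring"
  let ?S = "\<lambda>l. \<Inter>B\<in>cobases n \<Delta>. var_power n B l :: 'k mpol set"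
  interpret U: UP_cring ?R "UP ?R"
    by (simp add: UP_cring_def cring_polynomial_ring)
  have J1: "J = ?S 1" using J Stanley_Reisner_ideal_eq_Inter by simp
  have spow: "symbolic_power ?R J l = ?S l" for l
    using symbolic_power_Stanley_Reisner[OF M] J by simp
  have ideal: "ideal (?S l) ?R" for l
    by (rule ideal_Inter_var_power[OF cobases_nonempty[OF M]])
  have carr: "?S l \<subseteq> carrier ?R" for l using ideal.Icarr[OF ideal] by blast
  have S0: "?S 0 = carrier ?R" using cobases_nonempty[OF M] by (simp add: var_power_0)
  have rees: "symbolic_rees ?R J = {f \<in> carrier (UP ?R). \<forall>l. up_ring.coeff (UP ?R) f l \<in> ?S l}"
    by (simp only: symbolic_rees_def spow)
  have sub: "subring (symbolic_rees ?R J) (UP ?R)"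
    unfolding rees
  proof (rule U.subring_filtration[OF ideal])
    show "\<one>\<^bsub>?R\<^esub> \<in> ?S 0" unfolding S0 by simp
    fix k l and a b :: "'k mpol"
    assume "a \<in> ?S k" "b \<in> ?S l"
    then show "a \<otimes>\<^bsub>?R\<^esub> b \<in> ?S (k + l)" by (auto intro: var_power_mult)
  qed
  have monom_rees: "up_ring.monom (UP ?R) a l \<in> symbolic_rees ?R J" if "a \<in> ?S l" for a l
  proof -
    have "a \<in> carrier ?R" using that carr by blast
    moreover have "0 \<in> ?S k" for k by (simp add: zero_in_var_power)
    ultimately show ?thesis
      unfolding rees using that by (auto simp del: polynomial_ring_simps(1))
  qed
  have SF: "SF n l J \<subseteq> ?S l" for l
    using SF_subset[of n J l] ideal[of l] spow[of l] by simp
  show GR: "G \<subseteq> symbolic_rees ?R J"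
    unfolding G times_t_power_def using monom_rees J1 SF by blast
  let ?H = "times_t_power ?R (carrier ?R) 0 \<union> G"
  have HR: "?H \<subseteq> symbolic_rees ?R J"
    using GR monom_rees[of _ 0] S0 unfolding times_t_power_def by blast
  then have Hc: "?H \<subseteq> carrier (UP ?R)" unfolding rees by blast
  have A: "subring (adjoin ?R G) (UP ?R)"
    unfolding adjoin_def by (rule U.P.generate_ring_is_subring[OF Hc])
  have incl: "h \<in> adjoin ?R G" if "h \<in> ?H" for h
    unfolding adjoin_def using that by (rule generate_ring.incl)
  have times: "up_ring.monom (UP ?R) a k \<in> times_t_power ?R A k" if "a \<in> A" for a A k
    unfolding times_t_power_def using that by (rule imageI)
  have const: "up_ring.monom (UP ?R) a 0 \<in> adjoin ?R G" if "a \<in> carrier ?R" for a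
    by (rule incl[OF UnI1[OF times[OF that]]])
  have linear: "up_ring.monom (UP ?R) a 1 \<in> adjoin ?R G" if "a \<in> J" for a
    unfolding G by (rule incl[unfolded G, OF UnI2[OF UnI1[OF times[OF that]]]])
  have higher: "up_ring.monom (UP ?R) a k \<in> adjoin ?R G" if "k \<in> {2..c}" "a \<in> SF n k J" for a k
  proof -
    have "up_ring.monom (UP ?R) a k \<in> (\<Union>l\<in>{2..c}. times_t_power ?R (SF n l J) l)"
      using that(1) times[OF that(2), of k] by (rule UN_I)
    then show ?thesis unfolding G by (rule incl[unfolded G, OF UnI2[OF UnI2]])
  qed
  have mult: "up_ring.monom (UP ?R) (a * b) (k + l) \<in> adjoin ?R G"
    if "up_ring.monom (UP ?R) a k \<in> adjoin ?R G" "up_ring.monom (UP ?R) b l \<in> adjoin ?R G"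
      "a \<in> carrier ?R" "b \<in> carrier ?R" for a b k l
    using U.monom_mult[OF that(3,4), of k l] subringE(6)[OF A that(1,2)] by simp
  \<comment> \<open>The degree \<open>e\<close> may lie below the symbolic order of the squarefree
    monomial, which is how surplus degree gets discarded. The cases \<open>e = 0\<close>,
    \<open>e = 1\<close> and \<open>e \<ge> 2\<close> correspond to constants from the ring, to
    \<open>J\<close> and to \<open>SF\<close>.\<close>
  have squarefree: "up_ring.monom (UP ?R) (\<Prod>i\<in>C. indet i) e \<in> adjoin ?R G"
    if C: "C \<subseteq> {1..n}" and e: "e \<le> c" and le: "\<And>B. B \<in> cobases n \<Delta> \<Longrightarrow> e \<le> card (C \<inter> B)"
    for C e
  proof -
    have mem: "(\<Prod>i\<in>C. indet i) \<in> ?S e"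
      using le squarefree_in_var_power_iff[OF C cobases_subset] by blast
    then have SFe: "(\<Prod>i\<in>C. indet i) \<in> SF n e J"
      by (intro squarefree_monomial_in_SF[OF C]) (simp only: spow)
    consider "e = 0" | "e = 1" | "e \<in> {2..c}" using e by fastforce
    then show ?thesis
    proof cases
      case 1
      then show ?thesis using const carr[of e] mem by blast
    next
      case 2
      then show ?thesis using linear mem J1 by blast
    next
      case 3
      then show ?thesis using higher SFe by blast
    qed
  qed
  have monomial: "up_ring.monom (UP ?R) (Poly_Mapping.single m a) l \<in> adjoin ?R G"
    if m: "Poly_Mapping.keys m \<subseteq> {1..n}" and wt: "\<And>B. B \<in> cobases n \<Delta> \<Longrightarrow> l \<le> weight B m"
    for m a l
  proof -
    \<comment> \<open>The total degree of \<open>m\<close>, a convenient common bound for its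
      exponents.\<close>
    define N where "N = weight {1..n} m"
    have bound: "Poly_Mapping.lookup m i \<le> N" for i
    proof (cases "i \<in> {1..n}")
      case True
      then show ?thesis unfolding N_def weight_def by (intro member_le_sum) auto
    next
      case False
      then show ?thesis using m by (metis le0 not_in_keys_iff_lookup_eq_zero subsetD)
    qed
    have wt': "l \<le> weight ({1..n} - F) m" if "F \<in> facets \<Delta>" for F
      using wt that by (auto simp: cobases_def)
    obtain d where dl: "l \<le> (\<Sum>j<N. d j)"
      and dj: "\<And>j F. j < N \<Longrightarrow> F \<in> facets \<Delta> \<Longrightarrow> d j \<le> card (level m j \<inter> ({1..n} - F))"
      and dF: "\<And>j F. F \<in> facets \<Delta> \<Longrightarrow> d j \<le> card ({1..n} - F)"
      using matroid_level_decomposition[OF M m bound wt'] by metis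
    have dc: "d j \<le> c" for j
      using dF c facets_nonempty[OF M] by (force simp: cobases_def intro: order_trans)
    have lev: "level m j \<subseteq> {1..n}" for j using level_subset_keys m by blast
    have lev_carr: "(\<Prod>i\<in>level m j. indet i) \<in> carrier ?R" for j
      using lev[of j] finite_subset[OF lev[of j]]
      by (simp add: prod_indet keys_squarefree_exponent)
    \<comment> \<open>The product of the first \<open>k\<close> factors is reached with every degree
      up to the sum of their orders. Membership in the carrier is carried through the induction
      because \<open>mult\<close> requires it.\<close>
    have "(\<Prod>j<k. \<Prod>i\<in>level m j. indet i) \<in> carrier ?R
      \<and> up_ring.monom (UP ?R) (\<Prod>j<k. \<Prod>i\<in>level m j. indet i) e \<in> adjoin ?R G"
      if "k \<le> N" "e \<le> (\<Sum>j<k. d j)" for k e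
      using that
    proof (induction k arbitrary: e)
      case 0
      then show ?case using const[of 1] by simp
    next
      case (Suc k)
      \<comment> \<open>The first \<open>k\<close> factors absorb as much of the degree
        \<open>e\<close> as their orders allow; what remains is at most \<open>d k\<close> and goes
        to the new factor.\<close>
      define e' where "e' = min e (\<Sum>j<k. d j)"
      have e: "e = e' + (e - e')" "e - e' \<le> d k"
        using Suc.prems(2) by (auto simp: e'_def)
      have IH: "(\<Prod>j<k. \<Prod>i\<in>level m j. indet i) \<in> carrier ?R"
        "up_ring.monom (UP ?R) (\<Prod>j<k. \<Prod>i\<in>level m j. indet i) e' \<in> adjoin ?R G"
        using Suc.IH[of e'] Suc.prems(1) by (simp_all add: e'_def del: polynomial_ring_simps(1))
      have "e - e' \<le> card (level m k \<inter> B)" if "B \<in> cobases n \<Delta>" for B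
        using that dj[of k] Suc.prems(1) e(2) by (fastforce simp: cobases_def intro: order_trans)
      then have "up_ring.monom (UP ?R) (\<Prod>i\<in>level m k. indet i) (e - e') \<in> adjoin ?R G"
        using squarefree[OF lev, of "e - e'" k] e(2) dc[of k] by simp
      from mult[OF IH(2) this IH(1) lev_carr] U.R.m_closed[OF IH(1) lev_carr[of k]] e(1)
      show ?case by (simp del: polynomial_ring_simps(1))
    qed
    from this[of N l] dl
    have P: "(\<Prod>j<N. \<Prod>i\<in>level m j. indet i) \<in> carrier ?R"
      "up_ring.monom (UP ?R) (\<Prod>j<N. \<Prod>i\<in>level m j. indet i) l \<in> adjoin ?R G"
      by (simp_all del: polynomial_ring_simps(1))
    have "(\<Prod>j<k. \<Prod>i\<in>level m j. indet i)
        = (Poly_Mapping.single (\<Sum>j<k. squarefree_exponent (level m j)) 1 :: 'k mpol)" for k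
      using finite_subset[OF lev] by (induction k) (simp_all add: prod_indet mult_single)
    then have "(\<Prod>j<N. \<Prod>i\<in>level m j. indet i) = (Poly_Mapping.single m 1 :: 'k mpol)"
      using exponent_eq_sum_level[OF bound] by simp
    \<comment> \<open>The product of the levels has coefficient 1; the scalar \<open>a\<close> is
      supplied by a constant of \<open>t\<close>-degree 0.\<close>
    moreover have a: "Poly_Mapping.single 0 a \<in> carrier ?R" by simp
    ultimately show ?thesis
      using mult[OF const[OF a] P(2) a P(1)] by (simp add: mult_single)
  qed
  have "symbolic_rees ?R J \<subseteq> adjoin ?R G"
  proof
    fix f assume f: "f \<in> symbolic_rees ?R J"
    show "f \<in> adjoin ?R G"
    proof (rule U.subring_contains_if_monoms[OF A])
      show "f \<in> carrier (UP ?R)" using f by (simp add: rees)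
      fix l
      have h: "up_ring.coeff (UP ?R) f l \<in> ?S l" using f by (simp add: rees)
      \<comment> \<open>For fixed \<open>l\<close> the polynomials \<open>h\<close> with
        \<open>h t^l\<close> in the subalgebra form an additively closed set, so only the single
        terms of the coefficient have to be checked.\<close>
      have "up_ring.coeff (UP ?R) f l \<in> {h \<in> carrier ?R. up_ring.monom (UP ?R) h l \<in> adjoin ?R G}" (is "?h \<in> ?T")
      proof (rule poly_mapping_additive_closure)
        show "0 \<in> ?T" using subringE(2)[OF A] U.monom_zero by simp
        fix a b assume "a \<in> ?T" "b \<in> ?T"
        then show "a + b \<in> ?T"
          using U.monom_add[of a b l] subringE(7)[OF A, of "up_ring.monom (UP ?R) a l" "up_ring.monom (UP ?R) b l"]
            U.R.a_closed[of a b] by (simp del: polynomial_ring_simps(1))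
      next
        fix m assume "m \<in> Poly_Mapping.keys ?h"
        then have "Poly_Mapping.keys m \<subseteq> {1..n}" "\<And>B. B \<in> cobases n \<Delta> \<Longrightarrow> l \<le> weight B m"
          using h cobases_nonempty[OF M] by (auto simp: var_power_def)
        then show "Poly_Mapping.single m (Poly_Mapping.lookup ?h m) \<in> ?T"
          using monomial by simp
      qed
      then show "up_ring.monom (UP ?R) (up_ring.coeff (UP ?R) f l) l \<in> adjoin ?R G" by blast
    qed
  qed
  moreover have "adjoin ?R G \<subseteq> symbolic_rees ?R J"
    unfolding adjoin_def by (rule U.P.generate_ring_min_subring1[OF Hc sub HR])
  ultimately show "symbolic_rees ?R J = adjoin ?R G" by blast
qed

section \<open>The height as bound for the degrees of the generators\<close>

theorem proposition4p2:
  fixes n c :: nat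
    and J :: "((nat \<Rightarrow>\<^sub>0 nat) \<Rightarrow>\<^sub>0 'k::field) set"
  assumes "C_matroidal n J"
    and "height (polynomial_ring n) J = enat c"
  shows "symbolic_rees (polynomial_ring n) J =
           adjoin (polynomial_ring n)
             (times_t_power (polynomial_ring n) J 1 \<union>
              (\<Union>l\<in>{2..c}. times_t_power (polynomial_ring n) (SF n l J) l))
         \<and> symbolic_Noether_number (polynomial_ring n) J \<le> enat c"
proof -
  let ?R = "polynomial_ring n :: 'k mpol ring"
  define G where "G = times_t_power ?R J 1 \<union> (\<Union>l\<in>{2..c}. times_t_power ?R (SF n l J) l)"
  interpret U: UP_cring ?R "UP ?R"
    by (simp add: UP_cring_def cring_polynomial_ring)
  obtain \<Delta> where M: "matroid {1..n} \<Delta>" and J: "J = Stanley_Reisner_ideal n \<Delta>"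
    using assms(1) by (auto simp: C_matroidal_def)
  \<comment> \<open>The height hypothesis becomes a bound on the cobases: each of their primes sits
    on top of a chain as long as its number of variables.\<close>
  have c: "card B \<le> c" if "B \<in> cobases n \<Delta>" for B
    using card_cobase_le_height[OF M that, where 'k='k] assms(2) J by simp
  note rees = symbolic_rees_Stanley_Reisner[OF M J c G_def]
  have deg: "deg ?R f \<le> c" if f: "f \<in> G" for f
  proof -
    obtain l a where f_eq: "f = up_ring.monom (UP ?R) a l"
      and l: "l = 1 \<and> a \<in> J \<or> l \<in> {2..c} \<and> a \<in> SF n l J"
      using f unfolding G_def times_t_power_def by blast
    have "ideal J ?R"
      unfolding J Stanley_Reisner_ideal_eq_Inter
      by (rule ideal_Inter_var_power[OF cobases_nonempty[OF M]])
    from ideal.Icarr[OF this] have a: "a \<in> carrier ?R" using l ideal.Icarr[OF ideal_SF] by blast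
    show ?thesis
    proof (cases "l \<le> c")
      case True
      then show ?thesis using U.deg_monom_le[OF a, of l] f_eq by simp
    next
      case False
      \<comment> \<open>For \<open>c = 0\<close> the generator \<open>J t\<close> has \<open>t\<close>-degree above \<open>c\<close>, but then \<open>J = 0\<close>.\<close>
      then have "c = 0" "a \<in> J" using l by auto
      obtain B where B: "B \<in> cobases n \<Delta>" using cobases_nonempty[OF M] by blast
      then have "B = {}" using c[OF B] \<open>c = 0\<close> finite_subset[OF cobases_subset[OF B]] by simp
      then have "a \<in> var_power n {} 1"
        using B \<open>a \<in> J\<close> J Stanley_Reisner_ideal_eq_Inter[of n \<Delta>, where 'k='k] by blast
      then have "a = 0" by (auto simp: var_power_def weight_def simp flip: keys_eq_empty)
      then show ?thesis using U.monom_zero[of l] U.deg_zero f_eq by simp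
    qed
  qed
  \<comment> \<open>The generating set \<open>G\<close> witnesses that \<open>enat c\<close> belongs
    to the set whose infimum is taken.\<close>
  have "symbolic_Noether_number ?R J \<le> enat c"
    unfolding symbolic_Noether_number_def
    using rees deg by (intro Inf_lower) blast
  then show ?thesis using rees(1) by (simp add: G_def)
qed

end
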